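(* Let $A\in\mathbb{C}^{n\times n}$ have no multiple eigenvalues, i.e. its eigenvalues $\alpha_1,\dots,\alpha_n$ satisfy $\alpha_i\ne\alpha_j$ for $i\ne j$. Then the equivalence classes of eigenvalues determined by the block equivalence relation $\Bumpeq$ are independent of the Schur factorisation chosen for $A$.
   Context: A Schur factorisation of $A$ is $A=USU^*$ with $U$ unitary and $S=(t_{ij})$ upper triangular; the diagonal entries $\alpha_i=t_{ii}$ of $S$ are the eigenvalues of $A$ (in some order depending on the factorisation). Given such a factorisation: (a) $\alpha_i\bumpeq\alpha_j$ (directly related) if $i=j$, or $i<j$ and $t_{ij}\ne 0$, or $i>j$ and $t_{ji}\ne 0$; (b) $\alpha_i\Bumpeq\alpha_j$ (block equivalent) if there is a subset $\{\sigma_1,\dots,\sigma_m\}$ of $\{1,\dots,n\}$ with $\alpha_i\bumpeq\alpha_{\sigma_1}\bumpeq\cdots\bumpeq\alpha_{\sigma_m}\bumpeq\alpha_j$. The relation $\Bumpeq$ is an equivalence relation on the set $\{\alpha_i\}_{i=1}^n$. *)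

theory Defs
  imports Jordan_Normal_Form.Schur_Decomposition
begin

definition unitary_mat :: "complex mat \<Rightarrow> bool" where
  "unitary_mat U \<longleftrightarrow> square_mat U \<and> inverts_mat U (mat_adjoint U) \<and> inverts_mat (mat_adjoint U) U"

definition schur_factorisation :: "complex mat \<Rightarrow> complex mat \<Rightarrow> complex mat \<Rightarrow> bool" where
  "schur_factorisation A U S \<longleftrightarrow>
     U \<in> carrier_mat (dim_row A) (dim_row A) \<and> S \<in> carrier_mat (dim_row A) (dim_row A) \<and>
     unitary_mat U \<and> upper_triangular S \<and> A = U * S * mat_adjoint U"

text \<open>Both relations are determined by the positions \<open>i, j\<close> on the diagonal of \<open>S\<close>, so they
  are defined on indices (counted from 0) first; they are used only for indices below
  \<open>dim_row S\<close>.\<close>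

definition directly_related :: "complex mat \<Rightarrow> nat \<Rightarrow> nat \<Rightarrow> bool" where
  "directly_related S i j \<longleftrightarrow> i = j \<or> i < j \<and> S $$ (i, j) \<noteq> 0 \<or> i > j \<and> S $$ (j, i) \<noteq> 0"

definition block_equivalent :: "complex mat \<Rightarrow> nat \<Rightarrow> nat \<Rightarrow> bool" where
  "block_equivalent S i j \<longleftrightarrow>
     (\<exists>\<sigma>. set \<sigma> \<subseteq> {..<dim_row S} \<and> successively (directly_related S) (i # \<sigma> @ [j]))"

text \<open>The relation induced on the set of diagonal entries. It need not be transitive
  if diagonal entries repeat; see \<open>equiv_block_rel\<close> below for distinct entries.\<close>

definition block_rel :: "complex mat \<Rightarrow> (complex \<times> complex) set" where
  "block_rel S = {(S $$ (i, i), S $$ (j, j)) | i j.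
     i < dim_row S \<and> j < dim_row S \<and> block_equivalent S i j}"

definition block_classes :: "complex mat \<Rightarrow> complex set set" where
  "block_classes S = set (diag_mat S) // block_rel S"

lemma directly_related_sym: "directly_related S i j \<Longrightarrow> directly_related S j i"
  by (auto simp: directly_related_def)

lemma block_equivalent_refl: "block_equivalent S i i"
  unfolding block_equivalent_def by (rule exI[of _ "[]"]) (simp add: directly_related_def)

lemma block_equivalent_sym:
  assumes "block_equivalent S i j"
  shows "block_equivalent S j i"
proof -
  obtain \<sigma> where \<sigma>: "set \<sigma> \<subseteq> {..<dim_row S}" "successively (directly_related S) (i # \<sigma> @ [j])"
    using assms by (auto simp: block_equivalent_def)
  have "(\<lambda>x y. directly_related S y x) = directly_related S"
    by (auto simp: fun_eq_iff intro: directly_related_sym)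
  then have "successively (directly_related S) (rev (i # \<sigma> @ [j]))"
    using \<sigma>(2) by (metis successively_rev)
  then show ?thesis
    using \<sigma>(1) unfolding block_equivalent_def by (intro exI[of _ "rev \<sigma>"]) simp
qed

lemma block_equivalent_trans:
  assumes "block_equivalent S i j" "block_equivalent S j k" "j < dim_row S"
  shows "block_equivalent S i k"
proof -
  obtain \<sigma> \<tau> where \<sigma>: "set \<sigma> \<subseteq> {..<dim_row S}" "successively (directly_related S) (i # \<sigma> @ [j])"
    and \<tau>: "set \<tau> \<subseteq> {..<dim_row S}" "successively (directly_related S) (j # \<tau> @ [k])"
    using assms by (auto simp: block_equivalent_def)
  have "successively (directly_related S) ((i # \<sigma>) @ j # \<tau> @ [k])"
    using \<sigma>(2) \<tau>(2) successively_append_iff[of "directly_related S" "i # \<sigma>" "[j]"]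
      successively_append_iff[of "directly_related S" "i # \<sigma>" "j # \<tau> @ [k]"] by simp
  then show ?thesis
    using \<sigma>(1) \<tau>(1) assms(3) unfolding block_equivalent_def
    by (intro exI[of _ "\<sigma> @ j # \<tau>"]) simp
qed

lemma equiv_block_rel:
  assumes "distinct (diag_mat S)"
  shows "equiv (set (diag_mat S)) (block_rel S)"
proof (rule equivI)
  have inj: "i = j" if "S $$ (i, i) = S $$ (j, j)" "i < dim_row S" "j < dim_row S" for i j
    using assms that by (auto simp: diag_mat_def distinct_map inj_on_def)
  show "block_rel S \<subseteq> set (diag_mat S) \<times> set (diag_mat S)"
    by (auto simp: block_rel_def diag_mat_def)
  show "refl_on (set (diag_mat S)) (block_rel S)"
    using block_equivalent_refl by (fastforce simp: refl_on_def block_rel_def diag_mat_def)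
  show "sym (block_rel S)"
    using block_equivalent_sym by (fastforce simp: sym_def block_rel_def)
  show "trans (block_rel S)"
  proof (rule transI)
    fix x y z assume "(x, y) \<in> block_rel S" "(y, z) \<in> block_rel S"
    then obtain i j j' k where *: "x = S $$ (i, i)" "y = S $$ (j, j)" "y = S $$ (j', j')"
      "z = S $$ (k, k)" "i < dim_row S" "j < dim_row S" "j' < dim_row S" "k < dim_row S"
      "block_equivalent S i j" "block_equivalent S j' k"
      by (auto simp: block_rel_def)
    then have "block_equivalent S i k"
      using inj[of j j'] block_equivalent_trans by metis
    then show "(x, z) \<in> block_rel S"
      using * by (auto simp: block_rel_def)
  qed
qed

end

theory Submission
  imports Defs
begin

text \<open>
  Let \<open>A = U S U\<^sup>* = P T P\<^sup>*\<close> be two Schur factorisations. The unitary matrix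
  \<open>W = P\<^sup>* U\<close> satisfies \<open>T W = W S\<close>. The idea is to describe the block structure of a
  triangular factor by the diagonal matrices that commute with it, because commutation is
  transported by \<open>W\<close>, whereas the pattern of nonzero entries is not.

  A diagonal matrix commutes with \<open>S\<close> iff its entries are constant on directly related
  indices (\<open>commutes_mat_diag_iff\<close>), so the 0/1 matrix \<open>D\<close> that marks one block of \<open>S\<close> does.
  Its conjugate \<open>E = W D W\<^sup>*\<close> commutes with \<open>T\<close>. As the eigenvalues are distinct, everything
  that commutes with \<open>T\<close> is upper triangular (\<open>upper_triangular_commutant\<close>), and \<open>E\<close> is
  Hermitian because \<open>D\<close> is real and \<open>W\<close> is unitary, so that \<open>W\<^sup>*\<close>, by which the conjugation
  is formed, is the inverse of \<open>W\<close>. Hence \<open>E\<close> is diagonal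
  (\<open>unitary_conjugate_of_diagonal\<close>), and its entries are constant on the blocks of \<open>T\<close>.

  The eigenvalues themselves link the positions in \<open>S\<close> to those in \<open>T\<close>: an eigenvector \<open>v\<close>
  of \<open>S\<close> for the simple eigenvalue \<open>c\<close> is also an eigenvector of \<open>D\<close>, with the entry of \<open>D\<close>
  at the position of \<open>c\<close> as its eigenvalue. The same holds for \<open>W v\<close> with respect to \<open>T\<close>
  and \<open>E\<close>, so \<open>D\<close> and \<open>E\<close> carry equal entries at the positions of \<open>c\<close>
  (\<open>diagonal_commutant_values_agree\<close>). Thus two eigenvalues in one block of \<open>T\<close> cannot be
  separated by a block of \<open>S\<close> (\<open>block_rel_unitary_similar\<close>), and exchanging the two
  factorisations gives equality.
\<close>

section \<open>Eigenvectors of upper triangular matrices\<close>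

text \<open>In the row of the last nonzero entry \<open>k\<close> of \<open>v\<close>, the triangular form leaves only the term
  \<open>S\<^sub>k\<^sub>k v\<^sub>k\<close> of the product \<open>S v\<close>.\<close>

lemma eigenvector_last_nonzero_entry:
  fixes S :: "'a :: field mat"
  assumes S: "S \<in> carrier_mat n n" "upper_triangular S"
    and v: "v \<in> carrier_vec n" "v \<noteq> 0\<^sub>v n" and ev: "S *\<^sub>v v = c \<cdot>\<^sub>v v"
  obtains k where "k < n" "v $ k \<noteq> 0" "S $$ (k, k) = c"
proof -
  define K where "K = {k. k < n \<and> v $ k \<noteq> 0}"
  have "\<exists>k<n. v $ k \<noteq> 0"
    using v by (metis carrier_vecD eq_vecI index_zero_vec(1) index_zero_vec(2))
  then have K: "finite K" "K \<noteq> {}"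
    by (auto simp: K_def)
  define k where "k = Max K"
  have k: "k < n" "v $ k \<noteq> 0"
    using Max_in[OF K] by (auto simp: k_def K_def)
  have beyond: "v $ l = 0" if "k < l" "l < n" for l
  proof (rule ccontr)
    assume "v $ l \<noteq> 0"
    then have "l \<in> K"
      using that by (simp add: K_def)
    then show False
      using Max_ge[OF K(1), of l] that by (simp add: k_def)
  qed
  have "(S *\<^sub>v v) $ k = (\<Sum>l<n. S $$ (k, l) * v $ l)"
    using S v k by (simp add: scalar_prod_def atLeast0LessThan)
  also have "\<dots> = (\<Sum>l<n. if l = k then S $$ (k, k) * v $ k else 0)"
  proof (rule sum.cong[OF refl])
    fix l assume "l \<in> {..<n}"
    then show "S $$ (k, l) * v $ l = (if l = k then S $$ (k, k) * v $ k else 0)"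
      using beyond[of l] upper_triangularD[OF S(2), of l k] S(1) k(1)
      by (cases l k rule: linorder_cases) auto
  qed
  also have "\<dots> = S $$ (k, k) * v $ k"
    using k by simp
  finally have "S $$ (k, k) * v $ k = c * v $ k"
    using ev k v by simp
  then show ?thesis
    using that[of k] k by simp
qed

lemma eigenvalue_diagonal_entry:
  fixes S :: "'a :: field mat"
  assumes S: "S \<in> carrier_mat n n" "upper_triangular S"
  shows "eigenvalue S c \<longleftrightarrow> (\<exists>k<n. S $$ (k, k) = c)"
proof
  assume "eigenvalue S c"
  then obtain v where "v \<in> carrier_vec n" "v \<noteq> 0\<^sub>v n" "S *\<^sub>v v = c \<cdot>\<^sub>v v"
    unfolding eigenvalue_def eigenvector_def carrier_matD(1)[OF S(1)] by blast
  then show "\<exists>k<n. S $$ (k, k) = c"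
    by (blast elim: eigenvector_last_nonzero_entry[OF S])
next
  assume "\<exists>k<n. S $$ (k, k) = c"
  then have "c \<in> set (diag_mat S)"
    using S(1) by (auto simp: diag_mat_def)
  then have "poly (char_poly S) c = 0"
    unfolding char_poly_upper_triangular[OF S] by (rule linear_poly_root)
  then show "eigenvalue S c"
    using eigenvalue_root_char_poly[OF S(1)] by simp
qed

text \<open>A vanishing entry at position \<open>i\<close> thus forces a candidate eigenvector to be zero; this is the
  form in which the simplicity of the eigenvalue \<open>S\<^sub>i\<^sub>i\<close> is used below.\<close>

lemma eigenvector_entry_nonzero:
  fixes S :: "'a :: field mat"
  assumes S: "S \<in> carrier_mat n n" "upper_triangular S"
    and inj: "inj_on (\<lambda>k. S $$ (k, k)) {..<n}" and i: "i < n"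
    and v: "v \<in> carrier_vec n" "v \<noteq> 0\<^sub>v n" and ev: "S *\<^sub>v v = S $$ (i, i) \<cdot>\<^sub>v v"
  shows "v $ i \<noteq> 0"
proof -
  obtain k where k: "k < n" "v $ k \<noteq> 0" "S $$ (k, k) = S $$ (i, i)"
    using eigenvector_last_nonzero_entry[OF S v ev] by blast
  then have "k = i"
    using inj_onD[OF inj] i by auto
  then show ?thesis
    using k by simp
qed

section \<open>Matrices commuting with a triangular matrix\<close>

lemma mat_diag_mult_vec_index:
  fixes v :: "'a :: semiring_1 vec"
  assumes v: "v \<in> carrier_vec n" and i: "i < n"
  shows "(mat_diag n d *\<^sub>v v) $ i = d i * v $ i"
proof -
  have "(mat_diag n d *\<^sub>v v) $ i = (\<Sum>k<n. (if i = k then d k else 0) * v $ k)"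
    using v i by (simp add: mat_diag_def scalar_prod_def atLeast0LessThan)
  also have "\<dots> = (\<Sum>k<n. if k = i then d i * v $ i else 0)"
    by (rule sum.cong) auto
  finally show ?thesis
    using i by simp
qed

text \<open>The matrix \<open>D = mat_diag n d\<close> maps the eigenspace of \<open>S\<^sub>i\<^sub>i\<close> to itself, so \<open>D v - d\<^sub>i v\<close> lies in
  that eigenspace too; its entry at position \<open>i\<close> is zero.\<close>

lemma eigenvector_of_diagonal_commutant:
  fixes S D :: "'a :: field mat"
  assumes S: "S \<in> carrier_mat n n" "upper_triangular S"
    and inj: "inj_on (\<lambda>k. S $$ (k, k)) {..<n}" and i: "i < n"
    and comm: "S * mat_diag n d = mat_diag n d * S"
    and v: "v \<in> carrier_vec n" and ev: "S *\<^sub>v v = S $$ (i, i) \<cdot>\<^sub>v v"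
  shows "mat_diag n d *\<^sub>v v = d i \<cdot>\<^sub>v v"
proof -
  define D where "D = mat_diag n d"
  have D: "D \<in> carrier_mat n n"
    by (simp add: D_def)
  define u where "u = D *\<^sub>v v - d i \<cdot>\<^sub>v v"
  have u: "u \<in> carrier_vec n"
    using D v by (simp add: u_def)
  have "S *\<^sub>v u = S *\<^sub>v (D *\<^sub>v v) - S *\<^sub>v (d i \<cdot>\<^sub>v v)"
    unfolding u_def using S D v by (intro mult_minus_distrib_mat_vec[of _ n n]) auto
  also have "S *\<^sub>v (D *\<^sub>v v) = D *\<^sub>v (S *\<^sub>v v)"
    using S D v comm by (metis D_def assoc_mult_mat_vec)
  also have "D *\<^sub>v (S *\<^sub>v v) = S $$ (i, i) \<cdot>\<^sub>v (D *\<^sub>v v)"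
    unfolding ev using D v by (simp add: mult_mat_vec)
  also have "S *\<^sub>v (d i \<cdot>\<^sub>v v) = d i \<cdot>\<^sub>v (S $$ (i, i) \<cdot>\<^sub>v v)"
    using S v ev by (simp add: mult_mat_vec)
  also have "S $$ (i, i) \<cdot>\<^sub>v (D *\<^sub>v v) - d i \<cdot>\<^sub>v (S $$ (i, i) \<cdot>\<^sub>v v) = S $$ (i, i) \<cdot>\<^sub>v u"
    unfolding u_def using D v by (intro eq_vecI) (auto simp: algebra_simps)
  finally have "S *\<^sub>v u = S $$ (i, i) \<cdot>\<^sub>v u" .
  moreover have "u $ i = 0"
    using mat_diag_mult_vec_index[OF v i] D v i by (simp add: u_def D_def)
  ultimately have "u = 0\<^sub>v n"
    using eigenvector_entry_nonzero[OF S inj i u] by blast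
  then have zero: "(D *\<^sub>v v - d i \<cdot>\<^sub>v v) $ k = 0" if "k < n" for k
    using that by (simp add: u_def[symmetric])
  show ?thesis
    unfolding D_def[symmetric]
  proof (rule eq_vecI)
    fix k assume "k < dim_vec (d i \<cdot>\<^sub>v v)"
    then have "k < n"
      using v by simp
    then show "(D *\<^sub>v v) $ k = (d i \<cdot>\<^sub>v v) $ k"
      using zero[of k] D v by simp
  qed (use D v in simp)
qed

text \<open>Entry \<open>(i, j)\<close> of \<open>T X = X T\<close> involves, apart from \<open>X\<^sub>i\<^sub>j\<close>, only entries of \<open>X\<close> farther below
  the diagonal. Starting from the bottom left corner, these are already known to be zero, and
  \<open>T\<^sub>i\<^sub>i X\<^sub>i\<^sub>j = X\<^sub>i\<^sub>j T\<^sub>j\<^sub>j\<close> remains.\<close>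

lemma upper_triangular_commutant:
  fixes T X :: "'a :: field mat"
  assumes T: "T \<in> carrier_mat n n" "upper_triangular T"
    and inj: "inj_on (\<lambda>k. T $$ (k, k)) {..<n}"
    and X: "X \<in> carrier_mat n n" and comm: "T * X = X * T"
  shows "upper_triangular X"
proof -
  have "X $$ (i, j) = 0" if "j < i" "i < n" for i j
    using that
  proof (induction "n - (i - j)" arbitrary: i j rule: less_induct)
    case less
    have IH: "X $$ (k, l) = 0" if "k - l > i - j" "k < n" for k l
      using less that by auto
    have "(T * X) $$ (i, j) = (\<Sum>k<n. T $$ (i, k) * X $$ (k, j))"
      using less T X by (simp add: scalar_prod_def atLeast0LessThan)
    also have "\<dots> = (\<Sum>k<n. if k = i then T $$ (i, i) * X $$ (i, j) else 0)"
    proof (rule sum.cong[OF refl])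
      fix k assume "k \<in> {..<n}"
      then show "T $$ (i, k) * X $$ (k, j) = (if k = i then T $$ (i, i) * X $$ (i, j) else 0)"
        using IH[of k j] upper_triangularD[OF T(2), of k i] T(1) less.prems
        by (cases k i rule: linorder_cases) auto
    qed
    finally have TX: "(T * X) $$ (i, j) = T $$ (i, i) * X $$ (i, j)"
      using less.prems by simp
    have "(X * T) $$ (i, j) = (\<Sum>k<n. X $$ (i, k) * T $$ (k, j))"
      using less T X by (simp add: scalar_prod_def atLeast0LessThan)
    also have "\<dots> = (\<Sum>k<n. if k = j then X $$ (i, j) * T $$ (j, j) else 0)"
    proof (rule sum.cong[OF refl])
      fix k assume "k \<in> {..<n}"
      then show "X $$ (i, k) * T $$ (k, j) = (if k = j then X $$ (i, j) * T $$ (j, j) else 0)"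
        using IH[of i k] upper_triangularD[OF T(2), of j k] T(1) less.prems
        by (cases k j rule: linorder_cases) auto
    qed
    finally have XT: "(X * T) $$ (i, j) = X $$ (i, j) * T $$ (j, j)"
      using less.prems by simp
    have "T $$ (i, i) \<noteq> T $$ (j, j)"
      using inj_onD[OF inj, of i j] less.prems by auto
    then show ?case
      using TX XT comm by auto
  qed
  then show ?thesis
    using X by auto
qed

text \<open>This turns the combinatorial relation into an algebraic condition: commutation reads
  \<open>S\<^sub>i\<^sub>j d\<^sub>j = d\<^sub>i S\<^sub>i\<^sub>j\<close> entry by entry.\<close>

lemma commutes_mat_diag_iff:
  fixes S :: "complex mat"
  assumes S: "S \<in> carrier_mat n n" "upper_triangular S"
  shows "S * mat_diag n d = mat_diag n d * S \<longleftrightarrow>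
    (\<forall>i<n. \<forall>j<n. directly_related S i j \<longrightarrow> d i = d j)"
proof -
  have upperD: "S $$ (i, j) = 0" if "i < n" "j < n" "j < i" for i j
    using upper_triangularD[OF S(2), of j i] S(1) that by simp
  have "S * mat_diag n d = mat_diag n d * S \<longleftrightarrow>
      (\<forall>i<n. \<forall>j<n. S $$ (i, j) * d j = d i * S $$ (i, j))"
    unfolding mat_diag_mult_left[OF S(1)] mat_diag_mult_right[OF S(1)] by (auto simp: mat_eq_iff)
  also have "\<dots> \<longleftrightarrow> (\<forall>i<n. \<forall>j<n. directly_related S i j \<longrightarrow> d i = d j)"
  proof (intro iffI allI impI)
    fix i j
    assume eq: "\<forall>i<n. \<forall>j<n. S $$ (i, j) * d j = d i * S $$ (i, j)" and ij: "i < n" "j < n"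
      and rel: "directly_related S i j"
    have "S $$ (i, j) * d j = d i * S $$ (i, j)" "S $$ (j, i) * d i = d j * S $$ (j, i)"
      using eq ij by blast+
    then show "d i = d j"
      using rel by (auto simp: directly_related_def)
  next
    fix i j
    assume const: "\<forall>i<n. \<forall>j<n. directly_related S i j \<longrightarrow> d i = d j" and ij: "i < n" "j < n"
    show "S $$ (i, j) * d j = d i * S $$ (i, j)"
    proof (cases "S $$ (i, j) = 0")
      case False
      then have "directly_related S i j"
        using upperD[OF ij] by (cases i j rule: linorder_cases) (auto simp: directly_related_def)
      then have "d i = d j"
        using const ij by blast
      then show ?thesis by simp
    qed simp
  qed
  finally show ?thesis .
qed

lemma block_equivalent_invariant:
  assumes step: "\<And>i j. i < dim_row S \<Longrightarrow> j < dim_row S \<Longrightarrow> directly_related S i j \<Longrightarrow> f i = f j"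
    and "i < dim_row S" "j < dim_row S" "block_equivalent S i j"
  shows "f i = f j"
proof -
  obtain \<sigma> where "set \<sigma> \<subseteq> {..<dim_row S}" "successively (directly_related S) (i # \<sigma> @ [j])"
    using assms(4) by (auto simp: block_equivalent_def)
  then show ?thesis
    using assms(2)
  proof (induction \<sigma> arbitrary: i)
    case Nil
    then show ?case using step assms(3) by simp
  next
    case (Cons k \<sigma>)
    then have "f i = f k" "f k = f j" using step by auto
    then show ?case by simp
  qed
qed

lemma directly_related_imp_block_equivalent:
  "directly_related S i j \<Longrightarrow> block_equivalent S i j"
  unfolding block_equivalent_def by (rule exI[of _ "[]"]) simp

section \<open>Transport along a unitary similarity\<close>

text \<open>The conjugate commutes with \<open>T\<close> and is therefore upper triangular; it is Hermitian since
  \<open>d\<close> is real and \<open>V\<close> is the adjoint of \<open>W\<close>. Both together leave only the diagonal.\<close>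

lemma unitary_conjugate_of_diagonal:
  fixes S T W V :: "complex mat" and d :: "nat \<Rightarrow> complex"
  assumes S: "S \<in> carrier_mat n n" and T: "T \<in> carrier_mat n n" "upper_triangular T"
    and inj: "inj_on (\<lambda>k. T $$ (k, k)) {..<n}"
    and W: "W \<in> carrier_mat n n" and V: "V \<in> carrier_mat n n"
    and adj: "\<And>i j. i < n \<Longrightarrow> j < n \<Longrightarrow> V $$ (i, j) = cnj (W $$ (j, i))"
    and TW: "T * W = W * S" and VT: "V * T = S * V"
    and d: "\<And>k. d k \<in> \<real>"
    and comm: "S * mat_diag n d = mat_diag n d * S"
  obtains e where "W * mat_diag n d * V = mat_diag n e" "T * mat_diag n e = mat_diag n e * T"
proof -
  define D where "D = mat_diag n d"
  define E where "E = W * D * V"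
  have D: "D \<in> carrier_mat n n" by (simp add: D_def)
  have E: "E \<in> carrier_mat n n" using W D V by (simp add: E_def)
  note cs = S T(1) W V D
  have "T * E = (T * W) * (D * V)"
    unfolding E_def using cs by (simp add: assoc_mult_mat[of _ n n _ n _ n])
  also have "\<dots> = W * (S * D) * V"
    unfolding TW using cs by (simp add: assoc_mult_mat[of _ n n _ n _ n])
  also have "\<dots> = W * (D * S) * V"
    using comm by (simp add: D_def)
  also have "\<dots> = W * D * (V * T)"
    unfolding VT using cs by (simp add: assoc_mult_mat[of _ n n _ n _ n])
  also have "\<dots> = E * T"
    unfolding E_def using cs by (simp add: assoc_mult_mat[of _ n n _ n _ n])
  finally have TE: "T * E = E * T" .
  have entry: "E $$ (i, j) = (\<Sum>k<n. W $$ (i, k) * d k * cnj (W $$ (j, k)))" if "i < n" "j < n" for i j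
  proof -
    have "E = mat n n (\<lambda>(i, j). W $$ (i, j) * d j) * V"
      unfolding E_def D_def mat_diag_mult_right[OF W] ..
    then show ?thesis
      using that V by (simp add: scalar_prod_def atLeast0LessThan adj)
  qed
  have herm: "E $$ (i, j) = cnj (E $$ (j, i))" if "i < n" "j < n" for i j
    using that d by (simp add: entry Reals_cnj_iff mult_ac)
  have "upper_triangular E"
    using upper_triangular_commutant[OF T inj E TE] .
  then have low: "E $$ (i, j) = 0" if "j < i" "i < n" for i j
    using that E by auto
  have off: "E $$ (i, j) = 0" if "i \<noteq> j" "i < n" "j < n" for i j
    using that low[of i j] low[of j i] herm[of i j] by (cases i j rule: linorder_cases) auto
  have "E = mat_diag n (\<lambda>i. E $$ (i, i))"
    using E off by (intro eq_matI) (auto simp: mat_diag_def)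
  then show ?thesis
    using that[of "\<lambda>i. E $$ (i, i)"] TE by (simp add: E_def[symmetric] D_def[symmetric])
qed

text \<open>A common eigenvector \<open>v\<close> of \<open>S\<close> and \<open>mat_diag n d\<close> is carried by \<open>W\<close> to a common eigenvector
  of \<open>T\<close> and \<open>mat_diag n e\<close>, with the same two eigenvalues. Its entry at position \<open>j\<close> is
  nonzero, so \<open>e\<^sub>j\<close> can be read off there.\<close>

lemma diagonal_commutant_values_agree:
  fixes S T W V :: "'a :: field mat"
  assumes S: "S \<in> carrier_mat n n" "upper_triangular S" "inj_on (\<lambda>k. S $$ (k, k)) {..<n}"
    and T: "T \<in> carrier_mat n n" "upper_triangular T" "inj_on (\<lambda>k. T $$ (k, k)) {..<n}"
    and W: "W \<in> carrier_mat n n" and V: "V \<in> carrier_mat n n"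
    and VW: "V * W = 1\<^sub>m n" and TW: "T * W = W * S"
    and comm: "S * mat_diag n d = mat_diag n d * S"
    and conj: "W * mat_diag n d * V = mat_diag n e"
    and i: "i < n" and j: "j < n" and eq: "S $$ (i, i) = T $$ (j, j)"
  shows "d i = e j"
proof -
  define D where "D = mat_diag n d"
  have D: "D \<in> carrier_mat n n" by (simp add: D_def)
  have "eigenvalue S (S $$ (i, i))"
    using eigenvalue_diagonal_entry[OF S(1,2)] i by auto
  then obtain v where v: "v \<in> carrier_vec n" "v \<noteq> 0\<^sub>v n" and ev: "S *\<^sub>v v = S $$ (i, i) \<cdot>\<^sub>v v"
    unfolding eigenvalue_def eigenvector_def carrier_matD(1)[OF S(1)] by blast
  have Dv: "D *\<^sub>v v = d i \<cdot>\<^sub>v v"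
    unfolding D_def using eigenvector_of_diagonal_commutant[OF S i comm v(1) ev] .
  define w where "w = W *\<^sub>v v"
  have w: "w \<in> carrier_vec n" using W v by (simp add: w_def)
  have "V *\<^sub>v w = (V * W) *\<^sub>v v"
    unfolding w_def using V W v by simp
  then have Vw: "V *\<^sub>v w = v"
    using VW v by simp
  have w0: "w \<noteq> 0\<^sub>v n"
  proof
    assume "w = 0\<^sub>v n"
    then have "V *\<^sub>v 0\<^sub>v n = v"
      using Vw by simp
    moreover have "V *\<^sub>v 0\<^sub>v n = 0\<^sub>v n"
      using V by (intro eq_vecI) auto
    ultimately have "v = 0\<^sub>v n"
      by simp
    then show False using v by simp
  qed
  have Tw: "T *\<^sub>v w = T $$ (j, j) \<cdot>\<^sub>v w"
  proof -
    have "T *\<^sub>v w = (W * S) *\<^sub>v v"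
      unfolding w_def TW[symmetric] using T W v by simp
    also have "\<dots> = W *\<^sub>v (S *\<^sub>v v)"
      using S W v by simp
    also have "\<dots> = T $$ (j, j) \<cdot>\<^sub>v w"
      unfolding ev eq w_def using W v by (simp add: mult_mat_vec)
    finally show ?thesis .
  qed
  have wj: "w $ j \<noteq> 0"
    using eigenvector_entry_nonzero[OF T j w w0 Tw] .
  have "mat_diag n e *\<^sub>v w = W *\<^sub>v (D *\<^sub>v (V *\<^sub>v w))"
  proof -
    have "mat_diag n e = W * (D * V)"
      using assoc_mult_mat[OF W D V] conj by (simp add: D_def)
    then show ?thesis
      using W D V w by (simp add: assoc_mult_mat_vec[of _ n n _ n])
  qed
  also have "\<dots> = W *\<^sub>v (d i \<cdot>\<^sub>v v)"
    by (simp only: Vw Dv)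
  also have "\<dots> = d i \<cdot>\<^sub>v w"
    using W v by (simp add: w_def mult_mat_vec)
  finally have "(mat_diag n e *\<^sub>v w) $ j = d i * w $ j"
    using w j by simp
  then show ?thesis
    using wj mat_diag_mult_vec_index[OF w j, of e] by simp
qed

text \<open>The indicator of a block of \<open>S\<close> becomes, on the side of \<open>T\<close>, a function that is constant on
  blocks and takes the same values at equal eigenvalues. Hence eigenvalues that share a block of
  \<open>T\<close> lie on the same side of the indicator.\<close>

lemma block_rel_unitary_similar:
  fixes S T W V :: "complex mat"
  assumes S: "S \<in> carrier_mat n n" "upper_triangular S" "inj_on (\<lambda>k. S $$ (k, k)) {..<n}"
    and T: "T \<in> carrier_mat n n" "upper_triangular T" "inj_on (\<lambda>k. T $$ (k, k)) {..<n}"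
    and W: "W \<in> carrier_mat n n" and V: "V \<in> carrier_mat n n"
    and adj: "\<And>i j. i < n \<Longrightarrow> j < n \<Longrightarrow> V $$ (i, j) = cnj (W $$ (j, i))"
    and VW: "V * W = 1\<^sub>m n" and TW: "T * W = W * S" and VT: "V * T = S * V"
    and diag: "set (diag_mat T) \<subseteq> set (diag_mat S)"
  shows "block_rel T \<subseteq> block_rel S"
proof
  have dim: "dim_row S = n" "dim_row T = n"
    using S T by auto
  fix p assume "p \<in> block_rel T"
  then obtain i j where p: "p = (T $$ (i, i), T $$ (j, j))" and ij: "i < n" "j < n"
    and rel: "block_equivalent T i j"
    using T by (auto simp: block_rel_def)
  have "\<exists>k'<n. S $$ (k', k') = T $$ (k, k)" if "k < n" for k
    using diag that dim unfolding diag_mat_def by (force simp: subset_iff image_iff)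
  then obtain i' j' where i': "i' < n" "S $$ (i', i') = T $$ (i, i)"
    and j': "j' < n" "S $$ (j', j') = T $$ (j, j)"
    using ij by blast
  define d :: "nat \<Rightarrow> complex" where "d k = of_bool (block_equivalent S i' k)" for k
  have comm: "S * mat_diag n d = mat_diag n d * S"
    unfolding commutes_mat_diag_iff[OF S(1,2)]
  proof (intro allI impI)
    fix k l assume "k < n" "l < n" "directly_related S k l"
    then show "d k = d l"
      using block_equivalent_trans[of S i' k l] block_equivalent_trans[of S i' l k]
        directly_related_imp_block_equivalent[of S k l]
        directly_related_imp_block_equivalent[of S l k] directly_related_sym[of S k l] dim
      unfolding d_def by auto
  qed
  have real: "d k \<in> \<real>" for k
    by (simp add: d_def)
  obtain e where conj: "W * mat_diag n d * V = mat_diag n e"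
    and comm': "T * mat_diag n e = mat_diag n e * T"
    using unitary_conjugate_of_diagonal[OF S(1) T W V adj TW VT real comm] .
  have agree: "d k = e l" if "k < n" "l < n" "S $$ (k, k) = T $$ (l, l)" for k l
    using diagonal_commutant_values_agree[OF S T W V VW TW comm conj that] .
  have step: "e k = e l" if "k < dim_row T" "l < dim_row T" "directly_related T k l" for k l
    using comm' that unfolding commutes_mat_diag_iff[OF T(1,2)] dim by simp
  have "e i = e j"
    using block_equivalent_invariant[of T e, OF step _ _ rel] ij dim by simp
  then have "d j' = d i'"
    using agree[OF i'(1) ij(1) i'(2)] agree[OF j'(1) ij(2) j'(2)] by simp
  then have "block_equivalent S i' j'"
    using block_equivalent_refl[of S i'] by (auto simp: d_def)
  then show "p \<in> block_rel S"
    unfolding p block_rel_def i'(2)[symmetric] j'(2)[symmetric] using i'(1) j'(1) dim by blast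
qed

section \<open>Schur factorisations\<close>

lemma mat_adjoint_carrier: "A \<in> carrier_mat n m \<Longrightarrow> mat_adjoint A \<in> carrier_mat m n"
  by (auto simp: mat_adjoint_def)

lemma mat_adjoint_index:
  "i < dim_col A \<Longrightarrow> j < dim_row A \<Longrightarrow> mat_adjoint A $$ (i, j) = conjugate (A $$ (j, i))"
  by (simp add: mat_adjoint_def mat_of_rows_index)

lemma proots_prod_linear_factors:
  fixes xs :: "'a :: idom list"
  shows "proots (\<Prod>x\<leftarrow>xs. [:- x, 1:]) = mset xs"
proof (induction xs)
  case (Cons x xs)
  have "(\<Prod>x\<leftarrow>xs. [:- x, 1:]) \<noteq> 0"
    by (auto simp: prod_list_zero_iff)
  then show ?case
    using Cons by (simp add: proots_mult del: mult_pCons_left)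
qed simp

lemma schur_factorisation_diagonal:
  assumes A: "A \<in> carrier_mat n n" and cp: "char_poly A = (\<Prod>\<alpha>\<leftarrow>\<alpha>s. [:- \<alpha>, 1:])"
    and S: "schur_factorisation A U S"
  shows "mset (diag_mat S) = mset \<alpha>s"
proof -
  have c: "U \<in> carrier_mat n n" "S \<in> carrier_mat n n" "mat_adjoint U \<in> carrier_mat n n"
    and tri: "upper_triangular S" and un: "unitary_mat U" and AS: "A = U * S * mat_adjoint U"
    using A S mat_adjoint_carrier[of U n n] by (auto simp: schur_factorisation_def)
  have "similar_mat A S"
    using A c un AS unfolding unitary_mat_def inverts_mat_def
    by (intro similar_matI[of _ _ U "mat_adjoint U" n]) auto
  then have "(\<Prod>a\<leftarrow>diag_mat S. [:- a, 1:]) = (\<Prod>\<alpha>\<leftarrow>\<alpha>s. [:- \<alpha>, 1:])"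
    using cp char_poly_similar[of A S] char_poly_upper_triangular[OF c(2) tri] by simp
  then have "proots (\<Prod>a\<leftarrow>diag_mat S. [:- a, 1:]) = proots (\<Prod>\<alpha>\<leftarrow>\<alpha>s. [:- \<alpha>, 1:])"
    by simp
  then show ?thesis
    unfolding proots_prod_linear_factors .
qed

lemma block_rel_schur_subset:
  assumes A: "A \<in> carrier_mat n n" and cp: "char_poly A = (\<Prod>\<alpha>\<leftarrow>\<alpha>s. [:- \<alpha>, 1:])"
    and dist: "distinct \<alpha>s"
    and S: "schur_factorisation A U S" and T: "schur_factorisation A P T"
  shows "block_rel T \<subseteq> block_rel S"
proof -
  define U' where "U' = mat_adjoint U"
  define P' where "P' = mat_adjoint P"
  have c: "U \<in> carrier_mat n n" "S \<in> carrier_mat n n" "U' \<in> carrier_mat n n"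
      "P \<in> carrier_mat n n" "T \<in> carrier_mat n n" "P' \<in> carrier_mat n n"
    and tri: "upper_triangular S" "upper_triangular T"
    and AS: "A = U * S * U'" and AT: "A = P * T * P'"
    and U: "U * U' = 1\<^sub>m n" "U' * U = 1\<^sub>m n" and P: "P * P' = 1\<^sub>m n" "P' * P = 1\<^sub>m n"
    using A S T mat_adjoint_carrier[of U n n] mat_adjoint_carrier[of P n n]
    by (auto simp: schur_factorisation_def unitary_mat_def inverts_mat_def U'_def P'_def)
  have m: "mset (diag_mat S) = mset \<alpha>s" "mset (diag_mat T) = mset \<alpha>s"
    using schur_factorisation_diagonal[OF A cp] S T by auto
  then have "distinct (diag_mat S)" "distinct (diag_mat T)"
    using dist by (metis mset_eq_imp_distinct_iff)+
  then have inj: "inj_on (\<lambda>k. S $$ (k, k)) {..<n}" "inj_on (\<lambda>k. T $$ (k, k)) {..<n}"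
    using c by (auto simp: diag_mat_def distinct_map atLeast0LessThan)
  define W where "W = P' * U"
  define V where "V = U' * P"
  have WV: "W \<in> carrier_mat n n" "V \<in> carrier_mat n n"
    using c by (auto simp: W_def V_def)
  have VW: "V * W = 1\<^sub>m n"
  proof -
    have "V * W = U' * (P * P') * U"
      unfolding V_def W_def using c by (simp add: assoc_mult_mat[of _ n n _ n _ n])
    then show ?thesis using c U P by simp
  qed
  have "P' * A * U = (P' * P) * T * (P' * U)"
    unfolding AT using c by (simp add: assoc_mult_mat[of _ n n _ n _ n])
  moreover have "P' * A * U = (P' * U) * S * (U' * U)"
    unfolding AS using c by (simp add: assoc_mult_mat[of _ n n _ n _ n])
  ultimately have TW: "T * W = W * S"
    using c U P WV by (simp add: W_def)
  have "U' * A * P = (U' * U) * S * (U' * P)"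
    unfolding AS using c by (simp add: assoc_mult_mat[of _ n n _ n _ n])
  moreover have "U' * A * P = (U' * P) * T * (P' * P)"
    unfolding AT using c by (simp add: assoc_mult_mat[of _ n n _ n _ n])
  ultimately have VT: "V * T = S * V"
    using c U P WV by (simp add: V_def)
  have adj: "V $$ (i, j) = cnj (W $$ (j, i))" if "i < n" "j < n" for i j
    using that c unfolding V_def W_def
    by (simp add: scalar_prod_def U'_def P'_def mat_adjoint_index mult.commute)
  show ?thesis
    using block_rel_unitary_similar[OF c(2) tri(1) inj(1) c(5) tri(2) inj(2) WV adj VW TW VT]
      mset_eq_setD[of "diag_mat T" "diag_mat S"] m by simp
qed

theorem theorem6:
  fixes A U S U' S' :: "complex mat" and n :: nat and \<alpha>s :: "complex list"
  assumes "A \<in> carrier_mat n n"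
    and "char_poly A = (\<Prod>\<alpha>\<leftarrow>\<alpha>s. [:- \<alpha>, 1:])"
    and "distinct \<alpha>s"
    and "schur_factorisation A U S"
    and "schur_factorisation A U' S'"
  shows "block_classes S = block_classes S'"
proof -
  have "block_rel S = block_rel S'"
    using block_rel_schur_subset[OF assms(1-3) assms(4) assms(5)]
      block_rel_schur_subset[OF assms(1-3) assms(5) assms(4)] by (rule equalityI[rotated])
  moreover have "set (diag_mat S) = set (diag_mat S')"
    using schur_factorisation_diagonal[OF assms(1,2,4)] schur_factorisation_diagonal[OF assms(1,2,5)]
    by (intro mset_eq_setD) simp
  ultimately show ?thesis
    by (simp add: block_classes_def)
qed

end
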